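(* Let $z$ be a variable (or a positive rational number), and let $u$ and $v$ be positive integers. For all nonnegative integers $n$ and all $i = 1,2,\ldots,2^n$, \[ c^{(u,v)}_z(n,i)\, c^{(v,u)}_{z^{-1}}(n,2^n+1-i) = 1. \] If $u = v \geq 1$, then for all nonnegative integers $n$ and $i = 1,2,\ldots,2^n$, \[ c^{(u,u)}(n,i)\, c^{(u,u)}(n,2^n+1-i) = 1. \]
   Context: For positive integers $u,v$, let $L_u = \begin{pmatrix} 1 & 0 \\ u & 1\end{pmatrix}$ and $R_v = \begin{pmatrix} 1 & v \\ 0 & 1\end{pmatrix}$, acting as linear fractional transformations $L_u(w) = \frac{w}{uw+1}$ and $R_v(w) = w+v$. For a root $z$, the rooted infinite binary tree $\mathcal{T}^{(u,v)}_z$ is built inductively: row $0$ consists of $z$, and each vertex $w$ has left child $L_u(w)$ and right child $R_v(w)$. Denote by $c^{(u,v)}_z(n,i)$ the $i$th number (from left to right) on row $n$ of this tree, for $n \geq 0$ and $i = 1,\ldots,2^n$; thus $c^{(u,v)}_z(0,1) = z$, $c^{(u,v)}_z(n+1,2i-1) = L_u(c^{(u,v)}_z(n,i))$ and $c^{(u,v)}_z(n+1,2i) = R_v(c^{(u,v)}_z(n,i))$. In the second statement, $c^{(u,u)}(n,i)$ denotes the entries of the tree with root $z = 1$ (i.e. $c^{(u,u)}_1(n,i)$). *)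

theory Defs
  imports
    "HOL-Analysis.Cartesian_Space"
    "HOL-Computational_Algebra.Polynomial"
    "HOL-Computational_Algebra.Fraction_Field"
begin

definition L_mat :: "nat \<Rightarrow> int ^ 2 ^ 2" where
  "L_mat u = vector [vector [1, 0], vector [int u, 1]]"

definition R_mat :: "nat \<Rightarrow> int ^ 2 ^ 2" where
  "R_mat v = vector [vector [1, int v], vector [0, 1]]"

definition lft :: "int ^ 2 ^ 2 \<Rightarrow> 'a::field \<Rightarrow> 'a" where
  "lft A w = (of_int (A $ 1 $ 1) * w + of_int (A $ 1 $ 2)) /
             (of_int (A $ 2 $ 1) * w + of_int (A $ 2 $ 2))"

lemma lft_L_mat: "lft (L_mat u) w = w / (of_nat u * w + 1)"
  by (simp add: lft_def L_mat_def)

lemma lft_R_mat: "lft (R_mat v) w = w + of_nat v"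
  by (simp add: lft_def R_mat_def)

(* The rows of the tree with root z, each listed from left to right. *)
primrec tree_row :: "nat \<Rightarrow> nat \<Rightarrow> 'a::field \<Rightarrow> nat \<Rightarrow> 'a list" where
  "tree_row u v z 0 = [z]"
| "tree_row u v z (Suc n) =
     concat (map (\<lambda>w. [lft (L_mat u) w, lft (R_mat v) w]) (tree_row u v z n))"

(* Positions within a row are counted from 1, so the entry is
   meaningful only for 1 <= i <= 2 ^ n. *)
definition tree_entry :: "nat \<Rightarrow> nat \<Rightarrow> 'a::field \<Rightarrow> nat \<Rightarrow> nat \<Rightarrow> 'a" where
  "tree_entry u v z n i = tree_row u v z n ! (i - 1)"

lemma length_tree_row: "length (tree_row u v z n) = 2 ^ n"
  by (induction n) (simp_all add: length_concat comp_def sum_list_triv)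

lemma nth_concat_pairs:
  assumes "k < length xs"
  shows "concat (map (\<lambda>w. [f w, g w]) xs) ! (2 * k) = f (xs ! k)"
    and "concat (map (\<lambda>w. [f w, g w]) xs) ! Suc (2 * k) = g (xs ! k)"
  using assms by (induction xs arbitrary: k) (auto simp: nth_Cons split: nat.split)

lemma tree_entry_0: "tree_entry u v z 0 1 = z"
  by (simp add: tree_entry_def)

lemma tree_entry_left:
  assumes "1 \<le> i" "i \<le> 2 ^ n"
  shows "tree_entry u v z (Suc n) (2 * i - 1) = lft (L_mat u) (tree_entry u v z n i)"
proof -
  obtain k where "i = Suc k" using assms by (cases i) auto
  then show ?thesis
    using assms by (simp add: tree_entry_def nth_concat_pairs length_tree_row)
qed

lemma tree_entry_right:
  assumes "1 \<le> i" "i \<le> 2 ^ n"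
  shows "tree_entry u v z (Suc n) (2 * i) = lft (R_mat v) (tree_entry u v z n i)"
proof -
  obtain k where "i = Suc k" using assms by (cases i) auto
  then show ?thesis
    using assms by (simp add: tree_entry_def nth_concat_pairs length_tree_row)
qed

(* The indeterminate, as an element of the field of rational functions over the rationals. *)
definition zvar :: "rat poly fract" where
  "zvar = Fract [:0, 1:] 1"

end

theory Submission
  imports Defs
begin

text \<open>
  Inversion conjugates the two child maps: \<open>1 / L\<^sub>u(w) = R\<^sub>u(1 / w)\<close> and
  \<open>1 / R\<^sub>v(w) = L\<^sub>v(1 / w)\<close> for \<open>w \<noteq> 0\<close>. Hence inverting every entry turns the tree with
  parameters \<open>(u, v)\<close> and root \<open>z\<close> into the left-right mirror image of the tree with parameters
  \<open>(v, u)\<close> and root \<open>1 / z\<close>. Positivity of the root keeps all entries nonzero; it also covers an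
  indeterminate root, since the rational functions form an ordered field in which the
  indeterminate is positive.
\<close>

lemma inverse_lft_L_mat:
  fixes w :: "'a::field"
  assumes "w \<noteq> 0"
  shows "inverse (lft (L_mat u) w) = lft (R_mat u) (inverse w)"
  using assms by (simp add: lft_L_mat lft_R_mat field_simps)

lemma inverse_lft_R_mat:
  fixes w :: "'a::field"
  assumes "w \<noteq> 0"
  shows "inverse (lft (R_mat v) w) = lft (L_mat v) (inverse w)"
  using inverse_lft_L_mat[of "inverse w" v] assms by (metis inverse_inverse_eq inverse_zero)

lemma tree_row_pos:
  fixes z :: "'a::linordered_field"
  assumes "z > 0" "w \<in> set (tree_row u v z n)"
  shows "w > 0"
proof -
  have "lft (L_mat u) x > 0" "lft (R_mat v) x > 0" if "x > 0" for x :: 'a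
    using that by (simp_all add: lft_L_mat lft_R_mat add_nonneg_pos add_pos_nonneg)
  then show ?thesis
    using assms(2) by (induction n arbitrary: w) (auto simp: assms(1))
qed

lemma map_inverse_tree_row:
  fixes z :: "'a::linordered_field"
  assumes "z > 0"
  shows "map inverse (tree_row u v z n) = rev (tree_row v u (inverse z) n)"
proof (induction n)
  case (Suc n)
  \<comment> \<open>The children in the \<open>(v, u)\<close> tree, right one first: inversion swaps
    their order, and \<open>rev_concat\<close> restores it.\<close>
  let ?c = "\<lambda>w. [lft (R_mat u) w, lft (L_mat v) w]"
  have "map inverse (tree_row u v z (Suc n)) = concat (map ?c (map inverse (tree_row u v z n)))"
    unfolding tree_row.simps map_concat map_map
    using tree_row_pos[OF assms]
    by (intro arg_cong[of _ _ concat] map_cong)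
       (fastforce simp: inverse_lft_L_mat inverse_lft_R_mat)+
  also have "\<dots> = rev (tree_row v u (inverse z) (Suc n))"
    by (simp add: Suc.IH rev_concat rev_map comp_def)
  finally show ?case .
qed simp

lemma tree_entry_mult_mirror:
  fixes z :: "'a::linordered_field"
  assumes "z > 0" "i \<in> {1..2 ^ n}"
  shows "tree_entry u v z n i * tree_entry v u (inverse z) n (2 ^ n + 1 - i) = 1"
proof -
  \<comment> \<open>Counted from 0, the mirrored position has the shape used by
    \<open>rev_nth\<close>.\<close>
  have i: "i - 1 < 2 ^ n" "2 ^ n + 1 - i - 1 = 2 ^ n - Suc (i - 1)"
    using assms(2) by auto
  have "inverse (tree_entry u v z n i) = map inverse (tree_row u v z n) ! (i - 1)"
    using i by (simp add: tree_entry_def length_tree_row)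
  also have "\<dots> = tree_entry v u (inverse z) n (2 ^ n + 1 - i)"
    unfolding map_inverse_tree_row[OF assms(1)] tree_entry_def i(2)
    using i(1) by (simp add: rev_nth length_tree_row)
  finally have "tree_entry v u (inverse z) n (2 ^ n + 1 - i) = inverse (tree_entry u v z n i)" ..
  moreover have "tree_entry u v z n i > 0"
    using i(1) by (auto simp: tree_entry_def length_tree_row intro!: tree_row_pos[OF assms(1)] nth_mem)
  ultimately show ?thesis by simp
qed

lemma zvar_pos: "zvar > 0"
  proof -
  \<comment> \<open>A polynomial is positive iff its leading coefficient is; \<open>0 < 1\<close>
    concerns the denominator.\<close>
  have "(0::rat poly) < 1" "(0::rat poly) < [:0, 1:]"
    by (simp_all add: less_poly_def pos_poly_def)
  then show ?thesis
    by (simp add: zvar_def zero_less_Fract_iff)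
qed

theorem theorem2:
  fixes u v :: nat
  assumes "u > 0" and "v > 0"
  shows "(\<forall>n. \<forall>i\<in>{1..2 ^ n}.
            tree_entry u v zvar n i * tree_entry v u (inverse zvar) n (2 ^ n + 1 - i) = 1)
       \<and> (\<forall>z::rat. z > 0 \<longrightarrow> (\<forall>n. \<forall>i\<in>{1..2 ^ n}.
            tree_entry u v z n i * tree_entry v u (inverse z) n (2 ^ n + 1 - i) = 1))
       \<and> (u = v \<longrightarrow> (\<forall>n. \<forall>i\<in>{1..2 ^ n}.
            tree_entry u u (1::rat) n i * tree_entry u u (1::rat) n (2 ^ n + 1 - i) = 1))"
  \<comment> \<open>For \<open>u = v\<close>, the root 1, being its own inverse, makes both trees
    coincide.\<close>
  using tree_entry_mult_mirror[OF zvar_pos] tree_entry_mult_mirror[where 'a = rat]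
    tree_entry_mult_mirror[of "1::rat" _ _ u u]
  by (metis inverse_1 zero_less_one)

end
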